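(* Let $H$ be a separable complex Hilbert space with a fixed orthonormal basis $E=\{e_j\}$, and let $h\in H$ with $\|h\|=1$ and coordinates $h=(h_1,h_2,\dots,h_n,\dots)$ in the basis $E$. Then: (1) If there exists $j_0$ such that $|h_{j_0}|^2>1/2$, then $$hh^*-\mathrm{Diag}\big(1-|h_{j_0}|^2,\dots,1-|h_{j_0}|^2,\underbrace{|h_{j_0}|^2}_{j_0},1-|h_{j_0}|^2,\dots\big)=hh^*+(|h_{j_0}|^2-1)I+(1-2|h_{j_0}|^2)\,e_{j_0}e_{j_0}^*$$ is minimal, and the corresponding minimizing diagonal of $hh^*$ is unique if $h_j\neq0$ for all $j$. (2) If $|h_j|^2\le 1/2$ for every $j$, then $D_0=-\frac12 I$ is a minimizing diagonal for $hh^*$. Moreover, if $h_j\ne0$ for all $j$, then this minimizing diagonal is unique.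
   Context: $hh^*$ is the rank-one orthogonal projection $y\mapsto\langle y,h\rangle h$. "Diagonal" operators are the bounded operators that are diagonal in the basis $E$. An operator $A\in B(H)$ is minimal if $\|A\|\le\|A+D\|$ for all diagonal $D\in B(H)$ (operator norm). A diagonal $D_0\in B(H)$ is a minimizing diagonal of $hh^*$ if $\|hh^*+D_0\|\le\|hh^*+D\|$ for every diagonal $D\in B(H)$. The basis may be finite or countably infinite. *)

theory Defs
  imports "HOL-Analysis.Analysis"
begin

text \<open>
  The inner product is linear in the first and conjugate-linear in the second argument. The last
  axiom says that the norm is the one induced by the inner product; together with the norm axioms
  it gives positive definiteness.
\<close>

class complex_inner = real_normed_vector +
  fixes scaleC :: "complex \<Rightarrow> 'a \<Rightarrow> 'a" (infixr "*\<^sub>C" 75)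
    and cinner :: "'a \<Rightarrow> 'a \<Rightarrow> complex"
  assumes scaleC_add_right: "c *\<^sub>C (x + y) = c *\<^sub>C x + c *\<^sub>C y"
    and scaleC_add_left: "(c + d) *\<^sub>C x = c *\<^sub>C x + d *\<^sub>C x"
    and scaleC_scaleC: "c *\<^sub>C d *\<^sub>C x = (c * d) *\<^sub>C x"
    and scaleC_of_real: "complex_of_real r *\<^sub>C x = r *\<^sub>R x"
    and cinner_commute: "cinner x y = cnj (cinner y x)"
    and cinner_add_left: "cinner (x + y) z = cinner x z + cinner y z"
    and cinner_scaleC_left: "cinner (c *\<^sub>C x) y = c * cinner x y"
    and cinner_self: "cinner x x = complex_of_real ((norm x)\<^sup>2)"

class complex_hilbert = complex_inner + complete_space

global_interpretation complex_vector:
  vector_space "scaleC :: complex \<Rightarrow> 'a \<Rightarrow> 'a::complex_inner"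
proof
  show "1 *\<^sub>C x = x" for x :: 'a
    using scaleC_of_real[of 1 x] by simp
qed (simp_all add: scaleC_add_right scaleC_add_left scaleC_scaleC)

text \<open>
  Indexing a basis by a countable type (finite or infinite) makes the space separable; conversely,
  every orthonormal basis of a separable space is countable.
\<close>

definition orthonormal_basis :: "('i \<Rightarrow> 'a::complex_inner) \<Rightarrow> bool" where
  "orthonormal_basis e \<longleftrightarrow>
     (\<forall>j k. cinner (e j) (e k) = (if j = k then 1 else 0)) \<and>
     closure (complex_vector.span (range e)) = UNIV"

text \<open>
  Elements of \<open>B(H)\<close> are represented as functions; their operator norm is
  \<^const>\<open>onorm\<close>.
\<close>

definition bounded_clinear :: "('a::complex_inner \<Rightarrow> 'a) \<Rightarrow> bool" where
  "bounded_clinear A \<longleftrightarrow>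
     Vector_Spaces.linear scaleC scaleC A \<and> (\<exists>K. \<forall>x. norm (A x) \<le> K * norm x)"

definition diagonal_operator ::
    "('i \<Rightarrow> 'a::complex_inner) \<Rightarrow> ('a \<Rightarrow> 'a) \<Rightarrow> bool" where
  "diagonal_operator e D \<longleftrightarrow>
     bounded_clinear D \<and> (\<exists>d. \<forall>j. D (e j) = d j *\<^sub>C e j)"

text \<open>The operator with diagonal entries \<open>d\<close>; meaningful for bounded \<open>d\<close>.\<close>

definition Diag ::
    "('i \<Rightarrow> 'a::complex_inner) \<Rightarrow> ('i \<Rightarrow> complex) \<Rightarrow> 'a \<Rightarrow> 'a" where
  "Diag e d x = (\<Sum>\<^sub>\<infinity>j. (d j * cinner x (e j)) *\<^sub>C e j)"

text \<open>The operator \<open>h h\<^sup>*\<close>.\<close>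

definition rank_one :: "'a::complex_inner \<Rightarrow> 'a \<Rightarrow> 'a" where
  "rank_one h y = cinner y h *\<^sub>C h"

definition minimal_operator ::
    "('i \<Rightarrow> 'a::complex_inner) \<Rightarrow> ('a \<Rightarrow> 'a) \<Rightarrow> bool" where
  "minimal_operator e A \<longleftrightarrow>
     bounded_clinear A \<and>
     (\<forall>D. diagonal_operator e D \<longrightarrow> onorm A \<le> onorm (\<lambda>x. A x + D x))"

definition minimizing_diagonal ::
    "('i \<Rightarrow> 'a::complex_inner) \<Rightarrow> ('a \<Rightarrow> 'a) \<Rightarrow> ('a \<Rightarrow> 'a) \<Rightarrow> bool" where
  "minimizing_diagonal e A D\<^sub>0 \<longleftrightarrow>
     diagonal_operator e D\<^sub>0 \<and>
     (\<forall>D. diagonal_operator e D \<longrightarrow>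
        onorm (\<lambda>x. A x + D\<^sub>0 x) \<le> onorm (\<lambda>x. A x + D x))"

end

theory Submission imports Defs begin

text \<open>
  Part (1): for a diagonal \<open>D\<close> with entries \<open>d\<^sub>j\<close> and
  \<open>p = |h\<^bsub>j\<^sub>0\<^esub>|\<^sup>2\<close>, the vector
  \<open>(hh\<^sup>* + D) e\<^bsub>j\<^sub>0\<^esub>\<close> has squared norm
  \<open>p(1 - p) + |p + d\<^bsub>j\<^sub>0\<^esub>|\<^sup>2\<close>, so the norm of \<open>hh\<^sup>* + D\<close> is at least
  \<open>m = sqrt (p(1 - p))\<close>; splitting off \<open>e\<^bsub>j\<^sub>0\<^esub>\<close> orthogonally shows that the given operator
  attains \<open>m\<close>. If \<open>hh\<^sup>* + D\<close> has norm \<open>m\<close>, then \<open>e\<^bsub>j\<^sub>0\<^esub>\<close> is norming, hence the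
  other columns are orthogonal to column \<open>j\<^sub>0\<close>, which determines all \<open>d\<^sub>k\<close> with \<open>h\<^sub>k \<noteq> 0\<close>.

  Part (2): the weights \<open>|h\<^sub>j|\<^sup>2\<close> can be grouped into the sides of a (possibly degenerate)
  triangle, so three phases turn \<open>h\<close> into a unit vector \<open>v\<close> orthogonal to \<open>h\<close> with
  \<open>|v\<^sub>j| = |h\<^sub>j|\<close>. With \<open>A = hh\<^sup>* + D\<close> one gets \<open>\<langle>Ah,h\<rangle> - \<langle>Av,v\<rangle> = 1\<close> because \<open>D\<close> has the
  same quadratic form at \<open>h\<close> and \<open>v\<close>. So the norm of \<open>A\<close> is at least \<open>1/2\<close>, and equality
  forces \<open>Ah = h/2\<close>, that is \<open>Dh = -h/2\<close>.
\<close>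

section \<open>Complex inner products: sesquilinearity, Pythagoras, Cauchy-Schwarz\<close>

lemma cinner_add_right: "cinner x (y + z) = cinner x y + cinner x (z :: 'a::complex_inner)"
  by (metis cinner_add_left cinner_commute complex_cnj_add)

lemma cinner_scaleC_right: "cinner x (c *\<^sub>C y) = cnj c * cinner x (y :: 'a::complex_inner)"
  by (metis cinner_commute cinner_scaleC_left complex_cnj_mult)

lemma cinner_zero_left [simp]: "cinner 0 (y :: 'a::complex_inner) = 0"
  using cinner_add_left[of 0 0 y] by simp

lemma cinner_zero_right [simp]: "cinner (x :: 'a::complex_inner) 0 = 0"
  using cinner_add_right[of x 0 0] by simp

lemma cinner_minus_left: "cinner (- x) (y :: 'a::complex_inner) = - cinner x y"
  using cinner_add_left[of x "- x" y] by (simp add: eq_neg_iff_add_eq_0 add.commute)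

lemma cinner_minus_right: "cinner x (- y) = - cinner x (y :: 'a::complex_inner)"
  using cinner_add_right[of x y "- y"] by (simp add: eq_neg_iff_add_eq_0 add.commute)

lemma cinner_diff_left: "cinner (x - y) z = cinner x z - cinner y (z :: 'a::complex_inner)"
  using cinner_add_left[of x "- y" z] by (simp add: cinner_minus_left)

lemma cinner_diff_right: "cinner x (y - z) = cinner x y - cinner x (z :: 'a::complex_inner)"
  using cinner_add_right[of x y "- z"] by (simp add: cinner_minus_right)

lemma cinner_sum_left: "cinner (\<Sum>j\<in>S. f j) (y :: 'a::complex_inner) = (\<Sum>j\<in>S. cinner (f j) y)"
  by (induction S rule: infinite_finite_induct) (auto simp: cinner_add_left)

lemmas cinner_algebra_simps = cinner_add_left cinner_add_right cinner_diff_left cinner_diff_right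
  cinner_minus_left cinner_minus_right cinner_scaleC_left cinner_scaleC_right

lemma cinner_self_eq_1_iff: "cinner x x = 1 \<longleftrightarrow> norm (x :: 'a::complex_inner) = 1"
  unfolding cinner_self of_real_eq_1_iff by (simp add: abs_square_eq_1)

lemma norm_scaleC: "norm (c *\<^sub>C (x :: 'a::complex_inner)) = cmod c * norm x"
proof -
  have "complex_of_real ((norm (c *\<^sub>C x))\<^sup>2) = (c * cnj c) * complex_of_real ((norm x)\<^sup>2)"
    unfolding cinner_self[symmetric] by (simp add: cinner_scaleC_left cinner_scaleC_right)
  also have "\<dots> = complex_of_real ((cmod c * norm x)\<^sup>2)"
    by (simp add: complex_norm_square[symmetric] power_mult_distrib)
  finally have "(norm (c *\<^sub>C x))\<^sup>2 = (cmod c * norm x)\<^sup>2"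
    using of_real_eq_iff by blast
  then show ?thesis
    by (simp add: power2_eq_iff_nonneg)
qed

lemma norm_add_sq:
  "(norm (x + y))\<^sup>2 = (norm x)\<^sup>2 + (norm y)\<^sup>2 + 2 * Re (cinner x (y :: 'a::complex_inner))"
proof -
  have "complex_of_real ((norm (x + y))\<^sup>2)
      = complex_of_real ((norm x)\<^sup>2) + complex_of_real ((norm y)\<^sup>2) + (cinner x y + cnj (cinner x y))"
    unfolding cinner_self[symmetric] cinner_commute[of x y, symmetric]
    by (simp add: cinner_add_left cinner_add_right cinner_commute[of y x])
  also have "\<dots> = complex_of_real ((norm x)\<^sup>2 + (norm y)\<^sup>2 + 2 * Re (cinner x y))"
    by (simp add: complex_add_cnj)
  finally show ?thesis
    using of_real_eq_iff by blast
qed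

lemma norm_diff_sq:
  "(norm (x - y))\<^sup>2 = (norm x)\<^sup>2 + (norm y)\<^sup>2 - 2 * Re (cinner x (y :: 'a::complex_inner))"
  using norm_add_sq[of x "- y"] by (simp add: cinner_minus_right)

lemma norm_add_sq_orthogonal:
  "cinner x (y :: 'a::complex_inner) = 0 \<Longrightarrow> (norm (x + y))\<^sup>2 = (norm x)\<^sup>2 + (norm y)\<^sup>2"
  by (simp add: norm_add_sq)

text \<open>This is the residual of projecting \<open>x\<close> onto the line of \<open>y\<close>,
  scaled by \<open>(norm y)\<^sup>2\<close> so that no division occurs. It serves Cauchy-Schwarz, by
  nonnegativity, and the explicit operator bound for a dominant coordinate.\<close>

lemma norm_scaleC_diff_projection_sq:
  fixes x y :: "'a::complex_inner"
  shows "(norm (complex_of_real ((norm y)\<^sup>2) *\<^sub>C x - cinner x y *\<^sub>C y))\<^sup>2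
    = (norm y)\<^sup>2 * ((norm x)\<^sup>2 * (norm y)\<^sup>2 - (cmod (cinner x y))\<^sup>2)"
proof -
  have "cinner (complex_of_real ((norm y)\<^sup>2) *\<^sub>C x) (cinner x y *\<^sub>C y)
      = complex_of_real ((norm y)\<^sup>2 * (cmod (cinner x y))\<^sup>2)"
    unfolding of_real_mult complex_norm_square cinner_scaleC_left cinner_scaleC_right
    by (simp only: mult_ac)
  then show ?thesis
    unfolding norm_diff_sq norm_scaleC
    by (simp add: power2_eq_square norm_mult algebra_simps)
qed

lemma Cauchy_Schwarz_cinner: "cmod (cinner x y) \<le> norm x * norm (y :: 'a::complex_inner)"
proof (cases "y = 0")
  case False
  have "0 \<le> (norm y)\<^sup>2 * ((norm x)\<^sup>2 * (norm y)\<^sup>2 - (cmod (cinner x y))\<^sup>2)"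
    by (metis norm_scaleC_diff_projection_sq zero_le_power2)
  then have "(cmod (cinner x y))\<^sup>2 \<le> (norm x * norm y)\<^sup>2"
    using False by (simp add: zero_le_mult_iff power_mult_distrib)
  then show ?thesis
    by (rule power2_le_imp_le) simp
qed simp

lemma bounded_linear_cinner_left: "bounded_linear (\<lambda>x. cinner x (y :: 'a::complex_inner))"
proof (rule bounded_linear_intro[where K = "norm y"])
  show "cinner (r *\<^sub>R x) y = r *\<^sub>R cinner x y" for r x
    by (simp add: scaleC_of_real[symmetric] cinner_scaleC_left scaleR_conv_of_real)
qed (simp_all add: cinner_add_left Cauchy_Schwarz_cinner)

section \<open>Bounded complex-linear operators and diagonal operators\<close>

lemma bounded_clinear_iff:
  "bounded_clinear A \<longleftrightarrow>
     (\<forall>x y. A (x + y) = A x + A y) \<and> (\<forall>c x. A (c *\<^sub>C x) = c *\<^sub>C A x) \<and>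
     (\<exists>K. \<forall>x. norm (A x) \<le> K * norm x)"
  unfolding bounded_clinear_def Vector_Spaces.linear_iff
  using complex_vector.vector_space_axioms by blast

text \<open>The bridge to real bounded linear maps, through which \<open>onorm\<close> bounds and
  termwise application to infinite sums become available.\<close>

lemma bounded_clinear_imp_bounded_linear: "bounded_clinear A \<Longrightarrow> bounded_linear A"
proof -
  assume A: "bounded_clinear A"
  then obtain K where "\<And>x. norm (A x) \<le> norm x * K"
    unfolding bounded_clinear_iff by (auto simp: mult.commute)
  with A show ?thesis
    unfolding bounded_clinear_iff
    by (intro bounded_linear_intro[where K = K]) (simp_all flip: scaleC_of_real)
qed

lemma bounded_clinear_scaleC: "bounded_clinear (\<lambda>x :: 'a::complex_inner. c *\<^sub>C x)"
  unfolding bounded_clinear_iff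
  by (auto simp: scaleC_add_right scaleC_scaleC norm_scaleC mult.commute intro!: exI[of _ "cmod c"])

lemma bounded_clinear_rank_one: "bounded_clinear (rank_one h)"
proof -
  have "norm (rank_one h x) \<le> (norm h * norm h) * norm x" for x
    using mult_right_mono[OF Cauchy_Schwarz_cinner[of x h], of "norm h"]
    by (simp add: rank_one_def norm_scaleC mult_ac)
  then show ?thesis
    unfolding bounded_clinear_iff
    by (intro conjI allI exI[of _ "norm h * norm h"])
      (simp_all add: rank_one_def cinner_add_left scaleC_add_left cinner_scaleC_left scaleC_scaleC)
qed

lemma bounded_clinear_add:
  assumes "bounded_clinear A" "bounded_clinear B"
  shows "bounded_clinear (\<lambda>x. A x + B x)"
proof -
  obtain K L where "\<And>x. norm (A x) \<le> K * norm x" "\<And>x. norm (B x) \<le> L * norm x"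
    using assms unfolding bounded_clinear_iff by blast
  then have "norm (A x + B x) \<le> (K + L) * norm x" for x
    unfolding distrib_right by (rule norm_triangle_mono)
  with assms show ?thesis
    unfolding bounded_clinear_iff
    by (intro conjI allI exI[of _ "K + L"]) (simp_all add: scaleC_add_right)
qed

lemma diagonal_operator_add:
  assumes "diagonal_operator e A" "diagonal_operator e B"
  shows "diagonal_operator e (\<lambda>x. A x + B x)"
proof -
  obtain a b where "\<And>j. A (e j) = a j *\<^sub>C e j" "\<And>j. B (e j) = b j *\<^sub>C e j"
    using assms unfolding diagonal_operator_def by blast
  then have "A (e j) + B (e j) = (a j + b j) *\<^sub>C e j" for j
    by (simp add: scaleC_add_left)
  then have "\<exists>d. \<forall>j. A (e j) + B (e j) = d j *\<^sub>C e j"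
    by (intro exI[of _ "\<lambda>j. a j + b j"]) blast
  with assms bounded_clinear_add[of A B] show ?thesis
    unfolding diagonal_operator_def by blast
qed

lemma diagonal_operator_scaleC: "diagonal_operator e (\<lambda>x. c *\<^sub>C x)"
  unfolding diagonal_operator_def by (auto intro: bounded_clinear_scaleC)

section \<open>Orthonormal bases: expansions, Parseval, coordinates of diagonal operators\<close>

lemma orthonormal_basis_cinner:
  "orthonormal_basis e \<Longrightarrow> cinner (e j) (e k) = (if j = k then 1 else 0)"
  by (simp add: orthonormal_basis_def)

lemma orthonormal_basis_norm: "orthonormal_basis e \<Longrightarrow> norm (e j) = 1"
  by (simp add: orthonormal_basis_cinner flip: cinner_self_eq_1_iff)

lemma span_orthonormal_basis_finite:
  assumes "y \<in> complex_vector.span (range e)"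
  shows "\<exists>F g. finite F \<and> y = (\<Sum>j\<in>F. g j *\<^sub>C e j)"
  using assms
proof (induction rule: complex_vector.span_induct_alt)
  case base
  show ?case by (intro exI[of _ "{}"]) simp
next
  case (step c x y)
  then obtain F g k where F: "finite F" "y = (\<Sum>j\<in>F. g j *\<^sub>C e j)" "x = e k" by blast
  \<comment> \<open>The index \<open>k\<close> may already lie in \<open>F\<close>, so the two
    coefficient families are extended by zero to \<open>insert k F\<close> and added there.\<close>
  have "c *\<^sub>C x + y = (\<Sum>j\<in>insert k F. ((if j = k then c else 0) + (if j \<in> F then g j else 0)) *\<^sub>C e j)"
  proof -
    have 1: "(\<Sum>j\<in>insert k F. (if j = k then c else 0) *\<^sub>C e j) = c *\<^sub>C e k"
      using F(1) by (simp add: if_distrib[of "\<lambda>u. u *\<^sub>C _"] cong: if_cong)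
    have 2: "(\<Sum>j\<in>insert k F. (if j \<in> F then g j else 0) *\<^sub>C e j) = (\<Sum>j\<in>F. g j *\<^sub>C e j)"
      using F(1) by (intro sum.mono_neutral_cong_right) auto
    show ?thesis
      by (simp only: scaleC_add_left sum.distrib 1 2 F(2,3))
  qed
  with F(1) show ?case
    by (intro exI[of _ "insert k F"] exI[of _ "\<lambda>j. (if j = k then c else 0) + (if j \<in> F then g j else 0)"])
      simp
qed

text \<open>Best approximation: the partial sum over \<open>G\<close> is the orthogonal projection
  of \<open>x\<close> onto the span of the \<open>e j\<close> with \<open>j\<close> in
  \<open>G\<close>. By density some finite combination over \<open>F\<close> is within \<epsilon> of
  \<open>x\<close>, and for \<open>G\<close> containing \<open>F\<close> the projection is at least
  as close.\<close>

lemma orthonormal_basis_has_sum: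
  fixes x :: "'a::complex_inner"
  assumes e: "orthonormal_basis e"
  shows "((\<lambda>j. cinner x (e j) *\<^sub>C e j) has_sum x) UNIV"
  unfolding has_sum_def tendsto_iff eventually_finite_subsets_at_top
proof (intro allI impI)
  fix \<epsilon> :: real assume "\<epsilon> > 0"
  moreover have "x \<in> closure (complex_vector.span (range e))"
    using e by (simp add: orthonormal_basis_def)
  ultimately obtain y where y: "y \<in> complex_vector.span (range e)" "dist y x < \<epsilon>"
    by (meson closure_approachable)
  obtain F g where F: "finite F" "y = (\<Sum>j\<in>F. g j *\<^sub>C e j)"
    using span_orthonormal_basis_finite[OF y(1)] by blast
  have "dist (\<Sum>j\<in>G. cinner x (e j) *\<^sub>C e j) x < \<epsilon>" if G: "finite G" "F \<subseteq> G" for G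
  proof -
    define P where "P = (\<Sum>j\<in>G. cinner x (e j) *\<^sub>C e j)"
    have "cinner P (e k) = (if k \<in> G then cinner x (e k) else 0)" for k
      unfolding P_def cinner_sum_left cinner_scaleC_left orthonormal_basis_cinner[OF e]
      using G(1) by (simp add: if_distrib[of "(*) _"] cong: if_cong)
    then have PG: "cinner (e k) (x - P) = 0" if "k \<in> G" for k
      using that cinner_commute[of "e k" "x - P"] by (simp add: cinner_diff_left)
    \<comment> \<open>Both \<open>P\<close> and \<open>y\<close> are combinations over
      \<open>G\<close>, whereas \<open>x - P\<close> is orthogonal to every \<open>e k\<close> with
      \<open>k\<close> in \<open>G\<close>.\<close>
    have "cinner (P - y) (x - P) = 0"
    proof -
      have "cinner (\<Sum>j\<in>H. f j *\<^sub>C e j) (x - P) = 0" if "H \<subseteq> G" for H f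
        unfolding cinner_sum_left cinner_scaleC_left using PG that by (auto intro!: sum.neutral)
      from this[of G "\<lambda>j. cinner x (e j)"] this[OF G(2), of g] show ?thesis
        unfolding F(2) P_def[symmetric] by (simp add: cinner_diff_left[of P])
    qed
    then have "(norm ((P - y) + (x - P)))\<^sup>2 = (norm (P - y))\<^sup>2 + (norm (x - P))\<^sup>2"
      by (rule norm_add_sq_orthogonal)
    then have "(norm (x - P))\<^sup>2 \<le> (norm (x - y))\<^sup>2"
      by simp
    then have "norm (x - P) \<le> norm (x - y)"
      by (rule power2_le_imp_le) simp
    then show ?thesis
      using y(2) by (simp add: P_def dist_norm norm_minus_commute)
  qed
  with F(1) show "\<exists>F. finite F \<and> F \<subseteq> UNIV \<and>
      (\<forall>G. finite G \<and> F \<subseteq> G \<and> G \<subseteq> UNIV \<longrightarrow> dist (\<Sum>j\<in>G. cinner x (e j) *\<^sub>C e j) x < \<epsilon>)"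
    by blast
qed

lemma Parseval_has_sum:
  assumes "orthonormal_basis e"
  shows "((\<lambda>j. cinner x (e j) * cnj (cinner y (e j))) has_sum cinner x y) UNIV"
  using has_sum_bounded_linear[OF bounded_linear_cinner_left orthonormal_basis_has_sum[OF assms, of x], of y]
  by (simp add: o_def cinner_scaleC_left cinner_commute[of "e _" y])

lemma orthonormal_basis_ext:
  assumes "orthonormal_basis e" "\<And>j. cinner x (e j) = cinner y (e j)"
  shows "x = y"
  using orthonormal_basis_has_sum[OF assms(1), of x] orthonormal_basis_has_sum[OF assms(1), of y]
  by (simp add: assms(2)) (metis has_sum_unique)

text \<open>Continuity allows \<open>D\<close> to be applied termwise to the expansion of
  \<open>x\<close>, and pairing with \<open>e j\<close> leaves one term. The entry appears as
  \<open>cinner (D (e j)) (e j)\<close>, so no family of entries has to be named.\<close>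

lemma diagonal_operator_coeff:
  assumes e: "orthonormal_basis e" and D: "diagonal_operator e D"
  shows "cinner (D x) (e j) = cinner (D (e j)) (e j) * cinner x (e j)"
proof -
  obtain d where d: "\<And>j. D (e j) = d j *\<^sub>C e j"
    using D unfolding diagonal_operator_def by blast
  have bl: "bounded_clinear D"
    using D unfolding diagonal_operator_def by blast
  have "((\<lambda>k. cinner (D (cinner x (e k) *\<^sub>C e k)) (e j)) has_sum cinner (D x) (e j)) UNIV"
    using has_sum_bounded_linear[OF bounded_linear_compose[OF bounded_linear_cinner_left
          bounded_clinear_imp_bounded_linear[OF bl]] orthonormal_basis_has_sum[OF e, of x]]
    by (simp add: o_def)
  moreover have "cinner (D (cinner x (e k) *\<^sub>C e k)) (e j)
      = (if k = j then d j * cinner x (e j) else 0)" for k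
    using bl by (simp add: bounded_clinear_iff d cinner_scaleC_left orthonormal_basis_cinner[OF e])
  moreover have "((\<lambda>k. if k = j then d j * cinner x (e j) else 0) has_sum d j * cinner x (e j)) UNIV"
    by (rule has_sum_finite_neutralI[of "{j}"]) auto
  ultimately have "cinner (D x) (e j) = d j * cinner x (e j)"
    by (simp add: has_sum_unique)
  then show ?thesis
    by (simp add: d cinner_scaleC_left orthonormal_basis_cinner[OF e])
qed

section \<open>Tools: norming vectors, closing a triangle by phases, splitting weights at one
  half\<close>

text \<open>A first-order variation argument: if the inner product \<open>q\<close> were nonzero,
  moving \<open>u\<close> along \<open>x\<close> with a suitable phase would raise the squared norm
  of the image to first order, but that of the vector only to second order, violating
  \<open>bound\<close>.\<close>

lemma norming_vector_orthogonal:
  fixes A :: "'a::complex_inner \<Rightarrow> 'b::complex_inner"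
  assumes add: "\<And>x y. A (x + y) = A x + A y" and scale: "\<And>c x. A (c *\<^sub>C x) = c *\<^sub>C A x"
    and bound: "\<And>x. norm (A x) \<le> m * norm x"
    and u: "norm (A u) = m * norm u" and ortho: "cinner x u = 0"
  shows "cinner (A x) (A u) = 0"
proof (rule ccontr)
  define q where "q = cinner (A x) (A u)"
  assume "cinner (A x) (A u) \<noteq> 0"
  then have q: "(cmod q)\<^sup>2 > 0" by (simp add: q_def)
  define K where "K = m\<^sup>2 * (norm x)\<^sup>2 - (norm (A x))\<^sup>2"
  have K: "K \<ge> 0"
    using power_mono[OF bound[of x] norm_ge_zero, of 2] by (simp add: K_def power_mult_distrib)
  \<comment> \<open>The factor \<open>cnj q\<close> in \<open>t\<close> makes the cross term real
    and positive. The step size gives \<open>s * K < 1\<close>, so the gain \<open>2 * s\<close>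
    exceeds the loss \<open>s * (s * K)\<close>; the \<open>+ 1\<close> covers
    \<open>K = 0\<close>.\<close>
  define s where "s = 1 / (K + 1)"
  define t where "t = complex_of_real s * cnj q"
  have ct: "(cmod t)\<^sup>2 = s\<^sup>2 * (cmod q)\<^sup>2"
    by (simp add: t_def norm_mult power_mult_distrib)
  have tq: "cinner (t *\<^sub>C A x) (A u) = complex_of_real (s * (cmod q)\<^sup>2)"
    unfolding cinner_scaleC_left q_def[symmetric] t_def of_real_mult complex_norm_square
    by (simp add: mult_ac)
  have "(norm (A (t *\<^sub>C x + u)))\<^sup>2 \<le> (m * norm (t *\<^sub>C x + u))\<^sup>2"
    by (rule power_mono[OF bound norm_ge_zero])
  also have "\<dots> = m\<^sup>2 * ((cmod t)\<^sup>2 * (norm x)\<^sup>2 + (norm u)\<^sup>2)"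
    using ortho by (simp add: power_mult_distrib norm_add_sq cinner_scaleC_left norm_scaleC)
  finally have "(cmod t)\<^sup>2 * (norm (A x))\<^sup>2 + 2 * (s * (cmod q)\<^sup>2)
      \<le> m\<^sup>2 * ((cmod t)\<^sup>2 * (norm x)\<^sup>2)"
    by (simp add: add scale norm_add_sq[of "t *\<^sub>C A x"] tq norm_scaleC power_mult_distrib u
        distrib_left)
  then have "2 * s * (cmod q)\<^sup>2 \<le> s\<^sup>2 * K * (cmod q)\<^sup>2"
    by (simp add: ct K_def algebra_simps)
  then have "2 * s \<le> s * (s * K)"
    using q mult_right_le_imp_le[of "2 * s" "(cmod q)\<^sup>2" "s * (s * K)"]
    by (simp add: power2_eq_square[of s] mult.assoc)
  moreover have "s > 0" using K by (simp add: s_def)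
  moreover have "s * K < 1" using K by (simp add: s_def)
  ultimately show False by (simp add: mult_le_cancel_left_pos)
qed

text \<open>Rotating the side \<open>b\<close> against \<open>a\<close> changes the length of their
  sum continuously from \<open>a + b\<close>, at least \<open>c\<close>, to the distance of
  \<open>a\<close> and \<open>b\<close>, at most \<open>c\<close>. At an angle where the length is
  \<open>c\<close>, a third phase closes the triangle.\<close>

lemma closing_triangle:
  fixes a b c :: real
  assumes "a \<ge> 0" "b \<ge> 0" "c \<ge> 0" "a \<le> b + c" "b \<le> a + c" "c \<le> a + b"
  obtains r s t :: complex where "cmod r = 1" "cmod s = 1" "cmod t = 1" "r * a + s * b + t * c = 0"
proof -
  have "\<exists>\<theta>. 0 \<le> \<theta> \<and> \<theta> \<le> pi \<and> cmod (a + cis \<theta> * b) = c"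
  proof (rule IVT2')
    show "cmod (a + cis pi * b) \<le> c" using assms
      by (simp flip: of_real_diff)
    show "c \<le> cmod (a + cis 0 * b)" using assms
      by (simp flip: of_real_add)
    show "continuous_on {0..pi} (\<lambda>\<theta>. cmod (a + cis \<theta> * b))"
      by (intro continuous_intros)
  qed simp
  then obtain \<theta> where \<theta>: "cmod (a + cis \<theta> * b) = c" by blast
  show thesis
  \<comment> \<open>For a side of length zero the closing phase is arbitrary; otherwise it is
    obtained by dividing by \<open>c\<close>.\<close>
  proof (cases "c = 0")
    case True
    with \<theta> show thesis by (intro that[of 1 "cis \<theta>" 1]) auto
  next
    case False
    define t where "t = - (a + cis \<theta> * b) / c"
    have "cmod t = 1" using False assms(3) \<theta> by (simp add: t_def norm_divide norm_minus_cancel del: minus_add_distrib)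
    moreover have "t * c = - (a + cis \<theta> * b)" using False by (simp add: t_def)
    ultimately show thesis by (intro that[of 1 "cis \<theta>" t]) auto
  qed
qed

text \<open>Among finite sets of total weight at least 1/2, one of least cardinality falls below 1/2
  when any element \<open>k\<close> is removed. The sets \<open>F\<close>, \<open>{k}\<close> and
  the rest then serve as the three groups of weights.\<close>

lemma minimal_half_sum:
  fixes p :: "'i \<Rightarrow> real"
  assumes p: "(p has_sum 1) UNIV" and "\<And>j. p j \<ge> 0"
  obtains F k where "finite F" "k \<notin> F" "sum p F \<le> 1/2" "1/2 \<le> sum p F + p k" "sum p F + p k \<le> 1"
proof -
  \<comment> \<open>The tolerance 1/2 around the total 1 yields a finite set of weight above
    1/2.\<close>
  have "\<exists>F. finite F \<and> F \<subseteq> UNIV \<and> (\<forall>G. finite G \<and> F \<subseteq> G \<and> G \<subseteq> UNIV \<longrightarrow> dist (sum p G) 1 < 1/2)"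
    using p unfolding has_sum_def tendsto_iff eventually_finite_subsets_at_top by (meson half_gt_zero_iff zero_less_one)
  then obtain G0 where "finite G0" "dist (sum p G0) 1 < 1/2" by blast
  then have "finite G0 \<and> sum p G0 \<ge> 1/2" by (auto simp: dist_real_def abs_if split: if_splits)
  then obtain G where G: "finite G" "sum p G \<ge> 1/2"
    and min: "\<And>F. finite F \<and> sum p F \<ge> 1/2 \<Longrightarrow> card G \<le> card F"
    using ex_has_least_nat[of "\<lambda>F. finite F \<and> sum p F \<ge> 1/2" G0 card] by blast
  obtain k where k: "k \<in> G" using G(2) by fastforce
  have "sum p (G - {k}) < 1/2"
    using min[of "G - {k}"] card_Diff1_less[OF G(1) k] G(1) by fastforce
  moreover have "sum p (G - {k}) + p k = sum p G"
    using G(1) k by (simp add: sum.remove)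
  moreover have "sum p G \<le> 1"
    using has_sum_mono_neutral[OF has_sum_finite[OF G(1)] p] assms(2) by auto
  ultimately show thesis
    using G that[of "G - {k}" k] by auto
qed

section \<open>Passing between minimizing diagonals and norm bounds\<close>

lemma norm_rank_one_add_le:
  assumes "bounded_clinear D"
  shows "norm (rank_one h x + D x) \<le> onorm (\<lambda>x. rank_one h x + D x) * norm x"
  by (rule onorm[OF bounded_clinear_imp_bounded_linear[OF
        bounded_clinear_add[OF bounded_clinear_rank_one assms]]])

lemma minimizing_diagonalI:
  assumes "diagonal_operator e D\<^sub>0" "m \<ge> 0"
    and "\<And>x. norm (A x + D\<^sub>0 x) \<le> m * norm x"
    and "\<And>D. diagonal_operator e D \<Longrightarrow> m \<le> onorm (\<lambda>x. A x + D x)"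
  shows "minimizing_diagonal e A D\<^sub>0"
  unfolding minimizing_diagonal_def
  using assms by (meson onorm_bound order_trans)

text \<open>The starting point of both uniqueness proofs: an arbitrary minimizer inherits the bound
  known for the explicit one.\<close>

lemma minimizing_diagonal_onorm_le:
  assumes "minimizing_diagonal e A D" "diagonal_operator e D\<^sub>0" "m \<ge> 0"
    and "\<And>x. norm (A x + D\<^sub>0 x) \<le> m * norm x"
  shows "onorm (\<lambda>x. A x + D x) \<le> m"
  using assms unfolding minimizing_diagonal_def by (meson onorm_bound order_trans)

section \<open>A dominant coordinate: lower bound, uniqueness and the attained norm\<close>

text \<open>With \<open>a = cinner h (e j)\<close>, the column splits orthogonally into
  \<open>cnj a *\<^sub>C (h - a *\<^sub>C e j)\<close>, which does not depend on \<open>c\<close>,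
  and \<open>(p + c) *\<^sub>C e j\<close>.\<close>

lemma rank_one_column:
  assumes e: "orthonormal_basis e" and h: "norm h = 1" and p: "p = (cmod (cinner h (e j)))\<^sup>2"
  shows "(norm (rank_one h (e j) + c *\<^sub>C e j))\<^sup>2 = p * (1 - p) + (cmod (p + c))\<^sup>2"
proof -
  define a where "a = cinner h (e j)"
  have pa: "complex_of_real p = a * cnj a"
    unfolding p a_def complex_norm_square by simp
  have ej: "cinner (e j) (e j) = 1" "norm (e j) = 1"
    using e by (simp_all add: orthonormal_basis_cinner orthonormal_basis_norm)
  have ea: "cinner (e j) h = cnj a"
    by (simp add: a_def cinner_commute[of "e j" h])
  have "rank_one h (e j) + c *\<^sub>C e j = cnj a *\<^sub>C (h - a *\<^sub>C e j) + (p + c) *\<^sub>C e j"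
    by (simp add: rank_one_def ea pa complex_vector.scale_right_diff_distrib scaleC_add_left
        scaleC_scaleC mult.commute)
  moreover have "cinner (cnj a *\<^sub>C (h - a *\<^sub>C e j)) ((p + c) *\<^sub>C e j) = 0"
    by (simp add: cinner_algebra_simps ej a_def[symmetric])
  moreover have "(norm (h - a *\<^sub>C e j))\<^sup>2 = 1 - p"
  proof -
    have "cinner h (a *\<^sub>C e j) = complex_of_real p"
      by (simp add: cinner_scaleC_right a_def[symmetric] pa mult.commute)
    then show ?thesis
      by (simp add: norm_diff_sq norm_scaleC ej h p a_def[symmetric])
  qed
  ultimately show ?thesis
    by (simp add: norm_add_sq_orthogonal norm_scaleC power_mult_distrib ej p a_def[symmetric])
qed

lemma onorm_rank_one_add_diagonal_ge_column:
  assumes e: "orthonormal_basis e" and h: "norm h = 1" and p: "p = (cmod (cinner h (e j)))\<^sup>2"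
    and D: "diagonal_operator e D"
  shows "sqrt (p * (1 - p)) \<le> onorm (\<lambda>x. rank_one h x + D x)"
proof -
  obtain d where d: "\<And>j. D (e j) = d j *\<^sub>C e j"
    using D unfolding diagonal_operator_def by blast
  have "sqrt (p * (1 - p)) \<le> norm (rank_one h (e j) + D (e j))"
    unfolding d using rank_one_column[OF e h p, of "d j"] by (intro real_le_lsqrt) auto
  also have "\<dots> \<le> onorm (\<lambda>x. rank_one h x + D x) * norm (e j)"
    using D by (intro norm_rank_one_add_le) (simp add: diagonal_operator_def)
  finally show ?thesis
    by (simp add: orthonormal_basis_norm[OF e])
qed

lemma rank_one_add_diagonal_entries_unique:
  assumes e: "orthonormal_basis e" and h: "norm h = 1" and p: "p = (cmod (cinner h (e j)))\<^sup>2"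
    and p1: "p \<le> 1"
    and D: "diagonal_operator e D" and d: "\<And>j. D (e j) = d j *\<^sub>C e j"
    and le: "onorm (\<lambda>x. rank_one h x + D x) \<le> sqrt (p * (1 - p))"
    and nz: "\<And>j. cinner h (e j) \<noteq> 0"
  shows "d k = - complex_of_real (if k = j then p else 1 - p)"
proof -
  define m where "m = sqrt (p * (1 - p))"
  define A where "A x = rank_one h x + D x" for x
  have bcl: "bounded_clinear A"
    using D unfolding A_def[abs_def] diagonal_operator_def
    by (auto intro: bounded_clinear_add bounded_clinear_rank_one)
  have m2: "m\<^sup>2 = p * (1 - p)"
    using p1 by (simp add: m_def p)
  have bound: "norm (A x) \<le> m * norm x" for x
    using norm_rank_one_add_le[of D h x] D mult_right_mono[OF le norm_ge_zero[of x]]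
    by (simp add: A_def m_def diagonal_operator_def)
  have col: "(norm (A (e j)))\<^sup>2 = p * (1 - p) + (cmod (p + d j))\<^sup>2"
    unfolding A_def d by (rule rank_one_column[OF e h p])
  have "(norm (A (e j)))\<^sup>2 \<le> p * (1 - p)"
    using power_mono[OF bound[of "e j"], of 2] m2 by (simp add: orthonormal_basis_norm[OF e])
  \<comment> \<open>The independent part of column \<open>j\<close> already exhausts the permitted
    squared norm \<open>p * (1 - p)\<close>, so the part along \<open>e j\<close> must
    vanish.\<close>
  then have "(cmod (p + d j))\<^sup>2 \<le> 0"
    using col by linarith
  then have "complex_of_real p + d j = 0"
    by simp
  then have dj: "d j = - complex_of_real p"
    by (rule minus_unique[symmetric])
  have norming: "norm (A (e j)) = m * norm (e j)"
  proof -
    have "m \<ge> 0" using p1 by (simp add: m_def p)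
    moreover have "(norm (A (e j)))\<^sup>2 = m\<^sup>2"
      unfolding col dj m2 by simp
    ultimately show ?thesis
      by (simp add: orthonormal_basis_norm[OF e])
  qed
  show ?thesis
  proof (cases "k = j")
    case False
    then have ortho: "cinner (e k) (e j) = 0"
      by (simp add: orthonormal_basis_cinner[OF e])
    have "cinner (A (e k)) (A (e j)) = 0"
      by (rule norming_vector_orthogonal[OF _ _ bound norming ortho])
        (use bcl in \<open>simp_all add: bounded_clinear_iff\<close>)
    \<comment> \<open>With \<open>d j = - p\<close>, the terms of the expanded product share the two
      coordinates of \<open>h\<close> as factors. These are nonzero, so orthogonality of the columns
      forces the last factor to vanish.\<close>
    moreover have "cinner (A (e k)) (A (e j))
        = cinner h (e j) * cnj (cinner h (e k)) * ((1 - p) + d k)"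
    proof -
      have pa: "complex_of_real p = cinner h (e j) * cnj (cinner h (e j))"
        unfolding p complex_norm_square by simp
      have hh: "cinner h h = 1"
        by (simp add: cinner_self h)
      show ?thesis
        unfolding A_def rank_one_def d dj of_real_diff pa
        using False
        by (simp add: cinner_algebra_simps orthonormal_basis_cinner[OF e]
            cinner_commute[of "e _" h] hh algebra_simps)
    qed
    ultimately have "complex_of_real (1 - p) + d k = 0"
      using nz by simp
    then have "d k = - complex_of_real (1 - p)"
      by (rule minus_unique[symmetric])
    with False show ?thesis by simp
  qed (simp add: dj)
qed

text \<open>Relative to the splittings \<open>h = a *\<^sub>C e + w\<close> and
  \<open>y = y0 *\<^sub>C e + z\<close>, the image is a sum of three mutually orthogonal vectors
  along \<open>e\<close>, \<open>w\<close> and a residual \<open>u\<close>, so its squared norm can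
  be computed exactly before it is estimated.\<close>

lemma norm_two_rank_one_le:
  fixes h e :: "'a::complex_inner"
  assumes h: "norm h = 1" and e: "norm e = 1" and p: "p = (cmod (cinner h e))\<^sup>2" "p \<ge> 1/2"
  shows "norm (rank_one h y + complex_of_real (p - 1) *\<^sub>C y
           + complex_of_real (1 - 2 * p) *\<^sub>C rank_one e y) \<le> sqrt (p * (1 - p)) * norm y"
    (is "norm ?A \<le> _")
proof -
  define a w y0 z b where "a = cinner h e" and "w = h - a *\<^sub>C e" and "y0 = cinner y e"
    and "z = y - y0 *\<^sub>C e" and "b = cinner z w"
  have pa: "complex_of_real p = a * cnj a"
    unfolding p a_def complex_norm_square by simp
  have ee: "cinner e e = 1"
    by (simp add: cinner_self e)
  have we: "cinner w e = 0" and ze: "cinner z e = 0"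
    by (simp_all add: w_def z_def cinner_algebra_simps ee a_def y0_def)
  then have ew: "cinner e w = 0" and ez: "cinner e z = 0"
    by (metis cinner_commute complex_cnj_zero)+
  have hw: "h = a *\<^sub>C e + w" and yz: "y = y0 *\<^sub>C e + z"
    by (simp_all add: w_def z_def)
  have yh: "cinner y h = y0 * cnj a + b"
    unfolding hw yz by (simp add: cinner_algebra_simps ee ew ze b_def)
  have w2: "(norm w)\<^sup>2 = 1 - p"
    using arg_cong[OF hw, of "\<lambda>x. (norm x)\<^sup>2"]
    by (simp add: norm_add_sq_orthogonal cinner_scaleC_left ew norm_scaleC e h p a_def)
  then have p1: "p \<le> 1" by (metis diff_ge_0_iff_ge zero_le_power2)
  have y2: "(norm y)\<^sup>2 = (cmod y0)\<^sup>2 + (norm z)\<^sup>2"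
    by (subst yz) (simp add: norm_add_sq_orthogonal cinner_scaleC_left ez norm_scaleC e)
  \<comment> \<open>The part of \<open>z\<close> orthogonal to \<open>w\<close>, scaled by
    \<open>(norm w)\<^sup>2 = 1 - p\<close>.\<close>
  define u where "u = complex_of_real ((norm w)\<^sup>2) *\<^sub>C z - b *\<^sub>C w"
  have u2: "(norm u)\<^sup>2 = (1 - p) * ((1 - p) * (norm z)\<^sup>2 - (cmod b)\<^sup>2)"
    unfolding u_def b_def norm_scaleC_diff_projection_sq unfolding w2 by (simp add: mult.commute)
  have "?A = ((y0 * cnj a + b) * a + (p - 1) * y0 + (1 - 2 * p) * y0) *\<^sub>C e
      + ((y0 * cnj a) *\<^sub>C w + (b *\<^sub>C w + (p - 1) *\<^sub>C z))"
    unfolding rank_one_def yh unfolding y0_def[symmetric]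
    by (subst hw, subst yz)
      (simp add: scaleC_add_right scaleC_add_left scaleC_scaleC distrib_right ac_simps)
  \<comment> \<open>The operator has diagonal entry \<open>p + (p - 1) + (1 - 2 * p) = 0\<close> at
    \<open>e\<close>, so \<open>y0\<close> drops out of this component.\<close>
  also have "(y0 * cnj a + b) * a + (p - 1) * y0 + (1 - 2 * p) * y0 = a * b"
    unfolding of_real_diff of_real_mult pa by (simp add: algebra_simps)
  also have "b *\<^sub>C w + (p - 1) *\<^sub>C z = - u"
    unfolding u_def w2 by (simp add: complex_vector.scale_left_diff_distrib)
  finally have A: "?A = (a * b) *\<^sub>C e + ((y0 * cnj a) *\<^sub>C w + - u)" .
  have wu: "cinner w u = 0"
    unfolding u_def cinner_diff_right cinner_scaleC_right cinner_self
    by (simp add: b_def cinner_commute[of w z])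
  have eu: "cinner e u = 0"
    unfolding u_def cinner_diff_right cinner_scaleC_right by (simp add: ew ez)
  have "(norm ?A)\<^sup>2 = p * (cmod b)\<^sup>2 + (p * (cmod y0)\<^sup>2 * (1 - p)
      + (1 - p) * ((1 - p) * (norm z)\<^sup>2 - (cmod b)\<^sup>2))"
    unfolding A
    by (simp add: norm_add_sq_orthogonal cinner_algebra_simps ew eu wu norm_scaleC
        power_mult_distrib norm_mult e u2 w2 p(1) a_def[symmetric] del: add_uminus_conv_diff)
  also have "\<dots> = (2 * p - 1) * (cmod b)\<^sup>2 + p * (1 - p) * (cmod y0)\<^sup>2 + (1 - p)\<^sup>2 * (norm z)\<^sup>2"
    by (simp add: algebra_simps power2_eq_square)
  \<comment> \<open>Here \<open>p \<ge> 1/2\<close> enters: Cauchy-Schwarz for \<open>b\<close> may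
    be multiplied by \<open>2 * p - 1\<close>. Afterwards the coefficient of
    \<open>(norm z)\<^sup>2\<close> becomes \<open>p * (1 - p)\<close>, matching that of
    \<open>(cmod y0)\<^sup>2\<close>.\<close>
  also have "\<dots> \<le> (2 * p - 1) * ((1 - p) * (norm z)\<^sup>2) + p * (1 - p) * (cmod y0)\<^sup>2
      + (1 - p)\<^sup>2 * (norm z)\<^sup>2"
  proof -
    have "(cmod b)\<^sup>2 \<le> (1 - p) * (norm z)\<^sup>2"
      using power_mono[OF Cauchy_Schwarz_cinner[of z w] norm_ge_zero, of 2]
      by (simp add: b_def power_mult_distrib w2 mult.commute)
    then show ?thesis
      using p(2) by (intro add_right_mono mult_left_mono) auto
  qed
  also have "\<dots> = (sqrt (p * (1 - p)) * norm y)\<^sup>2"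
    unfolding power_mult_distrib y2 using p1 p(2) by (simp add: algebra_simps power2_eq_square)
  finally show ?thesis
    by (rule power2_le_imp_le) (use p1 p(2) in simp)
qed

section \<open>All weights at most one half: bound, orthogonal companion of \<open>h\<close>,
  rigidity\<close>

text \<open>The operator is half of the reflection \<open>2 hh* - I\<close>, so it multiplies every
  norm by exactly 1/2.\<close>

lemma norm_rank_one_minus_half_le:
  assumes "norm h = 1"
  shows "norm (rank_one h y + (- 1/2) *\<^sub>C y) \<le> 1/2 * norm y"
proof -
  have ip: "cinner (cinner y h *\<^sub>C h) ((1/2) *\<^sub>C y) = complex_of_real ((cmod (cinner y h))\<^sup>2 / 2)"
    using complex_norm_square[of "cinner y h"]
    by (simp add: cinner_scaleC_left cinner_scaleC_right cinner_commute[of h y])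
  have "(norm (rank_one h y - (1/2) *\<^sub>C y))\<^sup>2 = (1/2 * norm y)\<^sup>2"
    unfolding norm_diff_sq rank_one_def ip by (simp add: norm_scaleC assms power_divide)
  then have "norm (rank_one h y - (1/2) *\<^sub>C y) = 1/2 * norm y"
    by (simp add: power2_eq_iff_nonneg)
  then show ?thesis by simp
qed

lemma ex_orthogonal_same_moduli:
  assumes e: "orthonormal_basis e" and h: "norm h = 1"
    and half: "\<And>j. (cmod (cinner h (e j)))\<^sup>2 \<le> 1/2"
  obtains v where "cinner v h = 0" "\<And>j. cmod (cinner v (e j)) = cmod (cinner h (e j))"
proof -
  define p where "p j = (cmod (cinner h (e j)))\<^sup>2" for j
  have pc: "complex_of_real (p j) = cinner h (e j) * cnj (cinner h (e j))" for j
    unfolding p_def by (rule complex_norm_square)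
  have "((\<lambda>j. complex_of_real (p j)) has_sum complex_of_real 1) UNIV"
    using Parseval_has_sum[OF e, of h h] by (simp add: pc cinner_self h)
  then have "(p has_sum 1) UNIV"
    by (simp only: has_sum_of_real_iff)
  then obtain F k where F: "finite F" "k \<notin> F" "sum p F \<le> 1/2" "1/2 \<le> sum p F + p k"
      "sum p F + p k \<le> 1"
    by (rule minimal_half_sum) (auto simp: p_def)
  have pk: "p k \<le> 1/2" "p k \<ge> 0" and pF: "sum p F \<ge> 0"
    using half by (auto simp: p_def intro: sum_nonneg)
  \<comment> \<open>The three group weights sum to 1 and none exceeds 1/2, which is precisely the
    triangle inequality for each side.\<close>
  obtain r s t :: complex where rst: "cmod r = 1" "cmod s = 1" "cmod t = 1"
    "r * sum p F + s * p k + t * (1 - sum p F - p k) = 0"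
    by (rule closing_triangle[of "sum p F" "p k" "1 - sum p F - p k"]) (use F pk pF in auto)
  \<comment> \<open>The phases are \<open>r\<close> on \<open>F\<close>, \<open>s\<close> at
    \<open>k\<close> and \<open>t\<close> elsewhere. Writing this as \<open>t *\<^sub>C h\<close>
    plus a finite correction handles the possibly infinite rest without another series.\<close>
  define v where "v = t *\<^sub>C h + ((r - t) *\<^sub>C (\<Sum>j\<in>F. cinner h (e j) *\<^sub>C e j)
    + (s - t) *\<^sub>C cinner h (e k) *\<^sub>C e k)"
  have sumF: "cinner (\<Sum>j\<in>F. cinner h (e j) *\<^sub>C e j) (e i) = (if i \<in> F then cinner h (e i) else 0)" for i
    unfolding cinner_sum_left cinner_scaleC_left orthonormal_basis_cinner[OF e]
    using F(1) by (simp add: if_distrib[of "(*) _"] cong: if_cong)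
  have "cinner v (e i) = (if i \<in> F then r else if i = k then s else t) * cinner h (e i)" for i
    unfolding v_def using F(2)
    by (auto simp: cinner_add_left cinner_scaleC_left sumF orthonormal_basis_cinner[OF e] left_diff_distrib)
  then have "cmod (cinner v (e i)) = cmod (cinner h (e i))" for i
    by (simp add: norm_mult rst)
  moreover have "cinner v h = 0"
  proof -
    have "cinner (\<Sum>j\<in>F. cinner h (e j) *\<^sub>C e j) h = complex_of_real (sum p F)"
      by (simp add: cinner_sum_left cinner_scaleC_left pc cinner_commute[of "e _" h])
    then have "cinner v h = t + ((r - t) * sum p F + (s - t) * p k)"
      unfolding v_def
      by (simp add: cinner_add_left cinner_scaleC_left cinner_self h pc cinner_commute[of "e _" h])
    also have "\<dots> = r * sum p F + s * p k + t * (1 - sum p F - p k)"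
      by (simp add: algebra_simps)
    finally show ?thesis using rst(4) by simp
  qed
  ultimately show thesis using that by blast
qed

text \<open>By Parseval the quadratic form of a diagonal operator is the sum of its entries weighted
  by the squared moduli of the coordinates, so phases are invisible to it.\<close>

lemma diagonal_operator_cinner_self_eq:
  assumes e: "orthonormal_basis e" and D: "diagonal_operator e D"
    and "\<And>j. cmod (cinner v (e j)) = cmod (cinner h (e j))"
  shows "cinner (D v) v = cinner (D h) h"
proof -
  have "cinner v (e j) * cnj (cinner v (e j)) = cinner h (e j) * cnj (cinner h (e j))" for j
    by (simp add: complex_norm_square[symmetric] assms(3))
  then show ?thesis
    using Parseval_has_sum[OF e, of "D v" v] Parseval_has_sum[OF e, of "D h" h]
    unfolding diagonal_operator_coeff[OF e D, of v] diagonal_operator_coeff[OF e D, of h]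
    by (simp add: mult.assoc has_sum_unique)
qed

lemma onorm_rank_one_add_diagonal_ge_half:
  assumes e: "orthonormal_basis e" and h: "norm h = 1"
    and half: "\<And>j. (cmod (cinner h (e j)))\<^sup>2 \<le> 1/2"
    and D: "diagonal_operator e D"
  shows "1/2 \<le> onorm (\<lambda>x. rank_one h x + D x)"
    and "onorm (\<lambda>x. rank_one h x + D x) \<le> 1/2 \<Longrightarrow> D h = (- 1/2) *\<^sub>C h"
proof -
  obtain v where v: "cinner v h = 0" "\<And>j. cmod (cinner v (e j)) = cmod (cinner h (e j))"
    using ex_orthogonal_same_moduli[OF e h half] by blast
  have D_eq: "cinner (D v) v = cinner (D h) h"
    by (rule diagonal_operator_cinner_self_eq[OF e D v(2)])
  \<comment> \<open>The identity is itself a diagonal operator, so equal moduli also give equal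
    norms.\<close>
  have "cinner v v = cinner h h"
    using diagonal_operator_cinner_self_eq[OF e diagonal_operator_scaleC[of e 1] v(2)] by simp
  then have "norm v = 1"
    using h cinner_self_eq_1_iff by metis
  define A where "A x = rank_one h x + D x" for x
  define m where "m = onorm (\<lambda>x. rank_one h x + D x)"
  have bound: "norm (A x) \<le> m * norm x" for x
    unfolding A_def m_def using D by (intro norm_rank_one_add_le) (simp add: diagonal_operator_def)
  have re: "\<bar>Re (cinner (A x) x)\<bar> \<le> m" if "norm x = 1" for x
    using abs_Re_le_cmod[of "cinner (A x) x"] Cauchy_Schwarz_cinner[of "A x" x] bound[of x] that
    by simp
  \<comment> \<open>The rank-one part contributes 1 at \<open>h\<close> and 0 at \<open>v\<close>,
    and the diagonal contributions cancel. Two reals of modulus at most \<open>m\<close> that differ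
    by 1 force \<open>m \<ge> 1/2\<close>.\<close>
  have "cinner (A h) h - cinner (A v) v = 1"
    by (simp add: A_def rank_one_def cinner_add_left cinner_scaleC_left cinner_self h v(1) D_eq)
  then have diff: "Re (cinner (A h) h) - Re (cinner (A v) v) = 1"
    by (metis minus_complex.sel(1) one_complex.sel(1))
  show "1/2 \<le> onorm (\<lambda>x. rank_one h x + D x)"
    using re[OF h] re[OF \<open>norm v = 1\<close>] diff unfolding m_def[symmetric] by linarith
  assume "onorm (\<lambda>x. rank_one h x + D x) \<le> 1/2"
  then have m: "m \<le> 1/2" by (simp add: m_def)
  then have Re: "Re (cinner (A h) h) \<ge> 1/2"
    using re[OF h] re[OF \<open>norm v = 1\<close>] diff by linarith
  \<comment> \<open>Equality case: expanding the squared distance from \<open>A h\<close> to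
    \<open>(1/2) *\<^sub>C h\<close> gives at most 1/4 + 1/4 - 1/2 = 0.\<close>
  have "(norm (A h))\<^sup>2 \<le> (1/2)\<^sup>2"
    using bound[of h] h m by (intro power_mono) auto
  then have "(norm (A h - (1/2) *\<^sub>C h))\<^sup>2 \<le> 0"
    using Re by (simp add: norm_diff_sq norm_scaleC cinner_scaleC_right h power_divide)
  then have "A h = (1/2) *\<^sub>C h" by simp
  moreover have "A h = h + D h"
    by (simp add: A_def rank_one_def cinner_self h)
  ultimately have "D h = (1/2) *\<^sub>C h - 1 *\<^sub>C h"
    by (simp add: algebra_simps)
  also have "\<dots> = (1/2 - 1) *\<^sub>C h"
    by (simp only: complex_vector.scale_left_diff_distrib)
  also have "(1/2 - 1 :: complex) = - 1/2"
    by simp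
  finally show "D h = (- 1/2) *\<^sub>C h" .
qed

section \<open>The explicit diagonal and extensionality of diagonal operators\<close>

text \<open>The series is \<open>b\<close> times the basis expansion of \<open>x\<close> plus a
  single correction at \<open>k\<close>. Proving \<open>has_sum\<close> also shows that the
  \<open>infsum\<close> in \<open>Diag\<close> is a genuine limit and not the default value
  0.\<close>

lemma Diag_two_valued:
  fixes x :: "'a::complex_inner"
  assumes "orthonormal_basis e"
  shows "Diag e (\<lambda>j. if j = k then a else b) x = b *\<^sub>C x + (a - b) *\<^sub>C rank_one (e k) x"
proof -
  have "bounded_linear (\<lambda>y :: 'a. b *\<^sub>C y)"
    by (rule bounded_clinear_imp_bounded_linear[OF bounded_clinear_scaleC])
  from has_sum_bounded_linear[OF this orthonormal_basis_has_sum[OF assms, of x]]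
  have "((\<lambda>j. b *\<^sub>C cinner x (e j) *\<^sub>C e j) has_sum b *\<^sub>C x) UNIV"
    by (simp add: o_def)
  moreover have "((\<lambda>j. if j = k then (a - b) *\<^sub>C rank_one (e k) x else 0)
      has_sum (a - b) *\<^sub>C rank_one (e k) x) UNIV"
    by (rule has_sum_finite_neutralI[of "{k}"]) auto
  ultimately have "((\<lambda>j. b *\<^sub>C cinner x (e j) *\<^sub>C e j
      + (if j = k then (a - b) *\<^sub>C rank_one (e k) x else 0))
      has_sum (b *\<^sub>C x + (a - b) *\<^sub>C rank_one (e k) x)) UNIV"
    by (rule has_sum_add)
  moreover have "b *\<^sub>C cinner x (e j) *\<^sub>C e j + (if j = k then (a - b) *\<^sub>C rank_one (e k) x else 0)
      = ((if j = k then a else b) * cinner x (e j)) *\<^sub>C e j" for j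
    unfolding rank_one_def scaleC_scaleC
    by (simp add: left_diff_distrib complex_vector.scale_left_diff_distrib)
  ultimately show ?thesis
    unfolding Diag_def by (simp add: infsumI)
qed

lemma diagonal_operator_rank_one_basis:
  assumes "orthonormal_basis e"
  shows "diagonal_operator e (\<lambda>x. c *\<^sub>C rank_one (e k) x)"
proof -
  obtain K where "\<And>x. norm (rank_one (e k) x) \<le> K * norm x"
    using bounded_clinear_rank_one[of "e k"] unfolding bounded_clinear_iff by blast
  then have "norm (c *\<^sub>C rank_one (e k) x) \<le> cmod c * K * norm x" for x
    by (simp add: norm_scaleC mult.assoc mult_left_mono)
  then have bcl: "bounded_clinear (\<lambda>x. c *\<^sub>C rank_one (e k) x)"
    using bounded_clinear_rank_one[of "e k"] unfolding bounded_clinear_iff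
    by (intro conjI allI exI[of _ "cmod c * K"])
      (simp_all add: scaleC_add_right scaleC_scaleC mult.commute)
  have "c *\<^sub>C rank_one (e k) (e j) = (if j = k then c else 0) *\<^sub>C e j" for j
    by (simp add: rank_one_def orthonormal_basis_cinner[OF assms])
  then have "\<exists>d. \<forall>j. c *\<^sub>C rank_one (e k) (e j) = d j *\<^sub>C e j"
    by (intro exI[of _ "\<lambda>j. if j = k then c else 0"] allI)
  with bcl show ?thesis
    unfolding diagonal_operator_def by (rule conjI)
qed

lemma diagonal_operator_ext:
  assumes e: "orthonormal_basis e" and "diagonal_operator e D" "diagonal_operator e D'"
    and "\<And>j. D (e j) = D' (e j)"
  shows "D = D'"
proof
  fix x
  show "D x = D' x"
    by (rule orthonormal_basis_ext[OF e])
      (simp only: diagonal_operator_coeff[OF e assms(2), of x] diagonal_operator_coeff[OF e assms(3), of x]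
        assms(4))
qed

section \<open>Both cases assembled\<close>

theorem theorem8:
  fixes e :: "'i::countable \<Rightarrow> 'a::complex_hilbert" and h :: 'a
  assumes "orthonormal_basis e" and "norm h = 1"
  shows "(\<forall>j\<^sub>0.
           let p = (cmod (cinner h (e j\<^sub>0)))\<^sup>2;
               T = Diag e (\<lambda>j. complex_of_real (if j = j\<^sub>0 then p else 1 - p))
           in p > 1/2 \<longrightarrow>
             (\<lambda>y. rank_one h y - T y) =
               (\<lambda>y. rank_one h y + complex_of_real (p - 1) *\<^sub>C y
                  + complex_of_real (1 - 2 * p) *\<^sub>C rank_one (e j\<^sub>0) y) \<and>
             minimal_operator e (\<lambda>y. rank_one h y - T y) \<and>
             minimizing_diagonal e (rank_one h) (\<lambda>y. - T y) \<and>
             ((\<forall>j. cinner h (e j) \<noteq> 0) \<longrightarrow>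
               (\<forall>D. minimizing_diagonal e (rank_one h) D \<longrightarrow> D = (\<lambda>y. - T y)))) \<and>
         ((\<forall>j. (cmod (cinner h (e j)))\<^sup>2 \<le> 1/2) \<longrightarrow>
           minimizing_diagonal e (rank_one h) (\<lambda>y. (- 1/2) *\<^sub>C y) \<and>
           ((\<forall>j. cinner h (e j) \<noteq> 0) \<longrightarrow>
             (\<forall>D. minimizing_diagonal e (rank_one h) D \<longrightarrow> D = (\<lambda>y. (- 1/2) *\<^sub>C y))))"
proof -
  note e = assms(1) and h = assms(2)
  have case1: "let p = (cmod (cinner h (e j\<^sub>0)))\<^sup>2;
               T = Diag e (\<lambda>j. complex_of_real (if j = j\<^sub>0 then p else 1 - p))
           in p > 1/2 \<longrightarrow>
             (\<lambda>y. rank_one h y - T y) =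
               (\<lambda>y. rank_one h y + complex_of_real (p - 1) *\<^sub>C y
                  + complex_of_real (1 - 2 * p) *\<^sub>C rank_one (e j\<^sub>0) y) \<and>
             minimal_operator e (\<lambda>y. rank_one h y - T y) \<and>
             minimizing_diagonal e (rank_one h) (\<lambda>y. - T y) \<and>
             ((\<forall>j. cinner h (e j) \<noteq> 0) \<longrightarrow>
               (\<forall>D. minimizing_diagonal e (rank_one h) D \<longrightarrow> D = (\<lambda>y. - T y)))" for j\<^sub>0
  proof -
    define p where "p = (cmod (cinner h (e j\<^sub>0)))\<^sup>2"
    define T where "T = Diag e (\<lambda>j. complex_of_real (if j = j\<^sub>0 then p else 1 - p))"
    \<comment> \<open>The closed form of \<open>- T\<close>; once the two are identified, the
      infinite sum in \<open>Diag\<close> no longer has to be handled.\<close>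
    define D\<^sub>0 where "D\<^sub>0 y = complex_of_real (p - 1) *\<^sub>C y
        + complex_of_real (1 - 2 * p) *\<^sub>C rank_one (e j\<^sub>0) y" for y
    define m where "m = sqrt (p * (1 - p))"
    have p1: "p \<le> 1"
      using power_mono[OF Cauchy_Schwarz_cinner[of h "e j\<^sub>0"] norm_ge_zero, of 2]
      by (simp add: p_def h orthonormal_basis_norm[OF e])
    then have m0: "m \<ge> 0"
      by (simp add: m_def p_def)
    have T: "(\<lambda>y. - T y) = D\<^sub>0"
    proof
      fix y
      have "T y = complex_of_real (1 - p) *\<^sub>C y + complex_of_real (p - (1 - p)) *\<^sub>C rank_one (e j\<^sub>0) y"
        unfolding T_def if_distrib[of complex_of_real] of_real_diff[of p "1 - p"]
        by (rule Diag_two_valued[OF e])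
      then have "- T y = complex_of_real (- (1 - p)) *\<^sub>C y
          + complex_of_real (- (p - (1 - p))) *\<^sub>C rank_one (e j\<^sub>0) y"
        by (simp only: of_real_minus complex_vector.scale_minus_left minus_add_distrib)
      then show "- T y = D\<^sub>0 y"
        by (simp add: D\<^sub>0_def)
    qed
    have diag: "diagonal_operator e D\<^sub>0"
      unfolding D\<^sub>0_def
      by (intro diagonal_operator_add diagonal_operator_scaleC diagonal_operator_rank_one_basis[OF e])
    have lower: "m \<le> onorm (\<lambda>x. rank_one h x + D x)" if "diagonal_operator e D" for D
      unfolding m_def by (rule onorm_rank_one_add_diagonal_ge_column[OF e h p_def that])
    have D\<^sub>0_e: "D\<^sub>0 (e k) = (- complex_of_real (if k = j\<^sub>0 then p else 1 - p)) *\<^sub>C e k" for k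
      by (simp add: D\<^sub>0_def rank_one_def orthonormal_basis_cinner[OF e]
          flip: scaleC_add_left complex_vector.scale_minus_left)
    show ?thesis
      unfolding Let_def p_def[symmetric] T_def[symmetric]
    proof (intro impI conjI allI)
      assume p: "p > 1/2"
      have upper: "norm (rank_one h y + D\<^sub>0 y) \<le> m * norm y" for y
        using norm_two_rank_one_le[OF h orthonormal_basis_norm[OF e] p_def, of y] p
        by (simp add: D\<^sub>0_def m_def add.assoc)
      have A: "(\<lambda>y. rank_one h y - T y) = (\<lambda>y. rank_one h y + D\<^sub>0 y)"
        unfolding T[symmetric] by simp
      then show "(\<lambda>y. rank_one h y - T y) =
               (\<lambda>y. rank_one h y + complex_of_real (p - 1) *\<^sub>C y
                  + complex_of_real (1 - 2 * p) *\<^sub>C rank_one (e j\<^sub>0) y)"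
        by (simp only: D\<^sub>0_def add.assoc)
      show min: "minimizing_diagonal e (rank_one h) (\<lambda>y. - T y)"
        unfolding T by (rule minimizing_diagonalI[OF diag m0 upper lower])
      \<comment> \<open>Perturbing the operator by \<open>D\<close> amounts to replacing
        \<open>D\<^sub>0\<close> by the diagonal \<open>D\<^sub>0 + D\<close>, so minimality follows
        from that of \<open>D\<^sub>0\<close>.\<close>
      show "minimal_operator e (\<lambda>y. rank_one h y - T y)"
        unfolding A minimal_operator_def
      proof (intro conjI allI impI)
        show "bounded_clinear (\<lambda>y. rank_one h y + D\<^sub>0 y)"
          using diag by (intro bounded_clinear_add bounded_clinear_rank_one)
            (simp add: diagonal_operator_def)
        fix D assume "diagonal_operator e D"
        then have "diagonal_operator e (\<lambda>x. D\<^sub>0 x + D x)"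
          by (rule diagonal_operator_add[OF diag])
        then show "onorm (\<lambda>y. rank_one h y + D\<^sub>0 y) \<le> onorm (\<lambda>x. rank_one h x + D\<^sub>0 x + D x)"
          using min unfolding T minimizing_diagonal_def add.assoc by blast
      qed
      fix D assume nz: "\<forall>j. cinner h (e j) \<noteq> 0" and D: "minimizing_diagonal e (rank_one h) D"
      have D_diag: "diagonal_operator e D"
        using D by (simp add: minimizing_diagonal_def)
      then obtain d where d: "\<And>j. D (e j) = d j *\<^sub>C e j"
        unfolding diagonal_operator_def by blast
      have le: "onorm (\<lambda>x. rank_one h x + D x) \<le> sqrt (p * (1 - p))"
        using minimizing_diagonal_onorm_le[OF D diag m0 upper] by (simp add: m_def)
      have "d k = - complex_of_real (if k = j\<^sub>0 then p else 1 - p)" for k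
        by (rule rank_one_add_diagonal_entries_unique[OF e h p_def p1 D_diag d le]) (use nz in blast)
      then show "D = (\<lambda>y. - T y)"
        unfolding T by (intro diagonal_operator_ext[OF e D_diag diag]) (simp only: d D\<^sub>0_e)
    qed
  qed
  have case2: "minimizing_diagonal e (rank_one h) (\<lambda>y. (- 1/2) *\<^sub>C y)"
    and case2_unique: "\<And>D. \<forall>j. cinner h (e j) \<noteq> 0 \<Longrightarrow> minimizing_diagonal e (rank_one h) D \<Longrightarrow>
      D = (\<lambda>y. (- 1/2) *\<^sub>C y)"
    if half: "\<forall>j. (cmod (cinner h (e j)))\<^sup>2 \<le> 1/2"
  proof -
    have diag: "diagonal_operator e (\<lambda>y. (- 1/2) *\<^sub>C y)"
      by (rule diagonal_operator_scaleC)
    note ge_half = onorm_rank_one_add_diagonal_ge_half[OF e h half[rule_format]]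
    note upper = norm_rank_one_minus_half_le[OF h]
    show "minimizing_diagonal e (rank_one h) (\<lambda>y. (- 1/2) *\<^sub>C y)"
      by (rule minimizing_diagonalI[OF diag _ upper ge_half(1)]) simp_all
    fix D assume nz: "\<forall>j. cinner h (e j) \<noteq> 0" and D: "minimizing_diagonal e (rank_one h) D"
    have D_diag: "diagonal_operator e D"
      using D by (simp add: minimizing_diagonal_def)
    have Dh: "D h = (- 1/2) *\<^sub>C h"
      by (rule ge_half(2)[OF D_diag minimizing_diagonal_onorm_le[OF D diag _ upper]]) simp
    obtain d where d: "\<And>j. D (e j) = d j *\<^sub>C e j"
      using D_diag unfolding diagonal_operator_def by blast
    \<comment> \<open>Compare the coordinates at \<open>j\<close> of \<open>D h\<close> and
      \<open>(- 1/2) *\<^sub>C h\<close>, then cancel the nonzero coordinate of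
      \<open>h\<close>.\<close>
    have "d j = - 1/2" for j
    proof -
      have "d j * cinner h (e j) = (- 1/2) * cinner h (e j)"
        using diagonal_operator_coeff[OF e D_diag, of h j]
        unfolding Dh d cinner_scaleC_left orthonormal_basis_cinner[OF e] by simp
      with nz show ?thesis
        by (simp only: mult_cancel_right) simp
    qed
    then show "D = (\<lambda>y. (- 1/2) *\<^sub>C y)"
      by (intro diagonal_operator_ext[OF e D_diag diag]) (simp only: d)
  qed
  show ?thesis
    using case1 case2 case2_unique by blast
qed

end
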